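(* Let $s$ be a fixed nonzero complex number with $|s|<1$. Let $f:\mathcal A\times\mathcal A\to\mathcal X_\rho$ be a mapping with $f(x,0)=f(0,x)=0$ for all $x\in\mathcal A$ such that $$\rho\Big(f(\lambda(x+y),z+w)+f(\lambda(x+y),z-w)+f(\lambda(x-y),z+w)+f(\lambda(x-y),z-w)-4\lambda f(x,z)\Big)$$ $$\le\rho\Big(4s\big[f(\tfrac{x+y}{2},z-w)+f(\tfrac{x-y}{2},z+w)-f(x,z)+f(y,w)\big]\Big)$$ for all $\lambda\in\mathbb T$ and all $x,y,z,w\in\mathcal A$. Then $f$ is bi-additive.
   Context: $\mathbb T=\{\lambda\in\mathbb C:|\lambda|=1\}$. $\mathcal A$ is a complex algebra. $\mathcal X$ is a complex vector space with a convex modular $\rho$, i.e. a functional $\rho:\mathcal X\to[0,\infty]$ such that (i) $\rho(x)=0$ iff $x=0$; (ii) $\rho(\alpha x)=\rho(x)$ for every scalar $\alpha$ with $|\alpha|=1$; (iii) $\rho(\alpha x+\beta y)\le\alpha\rho(x)+\beta\rho(y)$ for all $x,y\in\mathcal X$ and $\alpha,\beta\ge0$ with $\alpha+\beta=1$. The modular space is $\mathcal X_\rho=\{x\in\mathcal X:\rho(\lambda x)\to0\text{ as }\lambda\to0\}$. A sequence $(x_n)$ in $\mathcal X_\rho$ is $\rho$-convergent to $x\in\mathcal X_\rho$ if $\rho(x_n-x)\to0$, and $\rho$-Cauchy if $\rho(x_n-x_m)\to0$ as $n,m\to\infty$. Standing assumptions: $\mathcal X_\rho$ is $\rho$-complete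 (every $\rho$-Cauchy sequence is $\rho$-convergent to an element of $\mathcal X_\rho$); $\rho$ has the Fatou property ($\rho(x)\le\liminf_n\rho(x_n)$ whenever $(x_n)$ is $\rho$-convergent to $x$); and $\rho$ satisfies the $\Delta_2$-condition with constant $0<\kappa\le2$, i.e. $\rho(2x)\le\kappa\rho(x)$ for all $x\in\mathcal X_\rho$. Bi-additive means additive in each variable separately. *)

theory Defs
  imports Complex_Main "HOL-Library.Extended_Nonnegative_Real"
begin

text \<open>Algebras are associative, but neither commutative nor unital in general.\<close>

locale complex_algebra = vector_space scale
  for scale :: "complex \<Rightarrow> 'a::ring \<Rightarrow> 'a" +
  assumes scale_mult_left: "scale c x * y = scale c (x * y)"
    and scale_mult_right: "x * scale c y = scale c (x * y)"

text \<open>Modulars take values in \<open>[0, \<infinity>]\<close>. Since \<open>0 * \<infinity> = 0\<close> in \<^typ>\<open>ennreal\<close>, the degenerate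
  cases \<open>a = 0\<close> and \<open>b = 0\<close> of convexity hold trivially.\<close>

locale convex_modular = vector_space scale
  for scale :: "complex \<Rightarrow> 'x::ab_group_add \<Rightarrow> 'x" +
  fixes \<rho> :: "'x \<Rightarrow> ennreal"
  assumes modular_eq_0_iff: "\<rho> x = 0 \<longleftrightarrow> x = 0"
    and modular_scale_unit: "cmod c = 1 \<Longrightarrow> \<rho> (scale c x) = \<rho> x"
    and modular_convex: "0 \<le> a \<Longrightarrow> 0 \<le> b \<Longrightarrow> a + b = 1 \<Longrightarrow>
      \<rho> (scale (complex_of_real a) x + scale (complex_of_real b) y) \<le> ennreal a * \<rho> x + ennreal b * \<rho> y"

definition modular_space :: "(complex \<Rightarrow> 'x \<Rightarrow> 'x) \<Rightarrow> ('x \<Rightarrow> ennreal) \<Rightarrow> 'x set" where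
  "modular_space scale \<rho> = {x. ((\<lambda>c. \<rho> (scale c x)) \<longlongrightarrow> 0) (at 0)}"

definition modular_convergent_to :: "('x::ab_group_add \<Rightarrow> ennreal) \<Rightarrow> (nat \<Rightarrow> 'x) \<Rightarrow> 'x \<Rightarrow> bool" where
  "modular_convergent_to \<rho> u x \<longleftrightarrow> (\<lambda>n. \<rho> (u n - x)) \<longlonglongrightarrow> 0"

definition modular_Cauchy :: "('x::ab_group_add \<Rightarrow> ennreal) \<Rightarrow> (nat \<Rightarrow> 'x) \<Rightarrow> bool" where
  "modular_Cauchy \<rho> u \<longleftrightarrow>
     ((\<lambda>(n, m). \<rho> (u n - u m)) \<longlongrightarrow> 0) (sequentially \<times>\<^sub>F sequentially)"

definition modular_complete :: "(complex \<Rightarrow> 'x::ab_group_add \<Rightarrow> 'x) \<Rightarrow> ('x \<Rightarrow> ennreal) \<Rightarrow> bool" where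
  "modular_complete scale \<rho> \<longleftrightarrow>
     (\<forall>u. (\<forall>n. u n \<in> modular_space scale \<rho>) \<and> modular_Cauchy \<rho> u \<longrightarrow>
       (\<exists>x \<in> modular_space scale \<rho>. modular_convergent_to \<rho> u x))"

definition Fatou_property :: "(complex \<Rightarrow> 'x::ab_group_add \<Rightarrow> 'x) \<Rightarrow> ('x \<Rightarrow> ennreal) \<Rightarrow> bool" where
  "Fatou_property scale \<rho> \<longleftrightarrow>
     (\<forall>u. \<forall>x \<in> modular_space scale \<rho>.
       (\<forall>n. u n \<in> modular_space scale \<rho>) \<and> modular_convergent_to \<rho> u x \<longrightarrow>
         \<rho> x \<le> liminf (\<lambda>n. \<rho> (u n)))"

definition Delta2_condition ::
    "(complex \<Rightarrow> 'x \<Rightarrow> 'x) \<Rightarrow> ('x \<Rightarrow> ennreal) \<Rightarrow> real \<Rightarrow> bool" where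
  "Delta2_condition scale \<rho> \<kappa> \<longleftrightarrow>
     (\<forall>x \<in> modular_space scale \<rho>. \<rho> (scale 2 x) \<le> ennreal \<kappa> * \<rho> x)"

definition bi_additive :: "('a::ab_group_add \<Rightarrow> 'a \<Rightarrow> 'x::ab_group_add) \<Rightarrow> bool" where
  "bi_additive f \<longleftrightarrow> (\<forall>y. additive (\<lambda>x. f x y)) \<and> (\<forall>x. additive (\<lambda>y. f x y))"

end

theory Submission
  imports Defs
begin

text \<open>By convexity \<open>\<rho> (s v) \<le> \<bar>s\<bar> \<rho> v\<close>, and the \<open>\<Delta>\<^sub>2\<close>-condition makes \<open>\<rho>\<close> finite on the modular space;
  hence \<open>\<rho> v \<le> \<rho> (s v)\<close> with \<open>\<bar>s\<bar> < 1\<close> forces \<open>v = 0\<close>. Taking \<open>\<lambda> = 1\<close>, \<open>y = x\<close>, \<open>w = 0\<close> makes the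
  right-hand side vanish and gives \<open>f (2 x, z) = 2 f (x, z)\<close>. Then for \<open>y = 0\<close> and for \<open>w = 0\<close> the
  inequality takes the form \<open>\<rho> v \<le> \<rho> (s v)\<close>, and \<open>v = 0\<close> is Jensen's equation in one of the
  variables.\<close>

context convex_modular
begin

text \<open>For sums, convexity with weights 1/2 bounds \<open>\<rho> (scale c (x + y))\<close> by
  the average of the modulars of \<open>scale (2 * c) x\<close> and \<open>scale (2 * c) y\<close>;
  both tend to 0 with \<open>c\<close>.\<close>

lemma subspace_modular_space: "subspace (modular_space scale \<rho>)"
proof (rule subspaceI)
  show "0 \<in> modular_space scale \<rho>"
    by (simp add: modular_space_def modular_eq_0_iff[THEN iffD2])
next
  have scaled: "((\<lambda>c. \<rho> (scale (c * a) x)) \<longlongrightarrow> 0) (at 0)"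
    if "x \<in> modular_space scale \<rho>" "a \<noteq> 0" for x a
  proof -
    \<comment> \<open>Since \<open>a \<noteq> 0\<close>, the substitution keeps \<open>c * a\<close>
      away from 0, as the punctured filter \<open>at 0\<close> demands.\<close>
    have "filterlim (\<lambda>c. c * a) (at 0) (at 0)"
      using that(2) by (auto simp: filterlim_at eventually_at_filter intro!: tendsto_eq_intros)
    with that(1) show ?thesis
      unfolding modular_space_def by (auto intro: filterlim_compose)
  qed
  show "scale a x \<in> modular_space scale \<rho>" if "x \<in> modular_space scale \<rho>" for a x
    using scaled[OF that, of a]
    by (cases "a = 0") (simp_all add: modular_space_def modular_eq_0_iff[THEN iffD2])
  fix x y
  assume xy: "x \<in> modular_space scale \<rho>" "y \<in> modular_space scale \<rho>"
  have "((\<lambda>c. ennreal (1/2) * \<rho> (scale (c * 2) x) + ennreal (1/2) * \<rho> (scale (c * 2) y)) \<longlongrightarrow>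
      ennreal (1/2) * 0 + ennreal (1/2) * 0) (at 0)"
    by (intro tendsto_add ennreal_tendsto_cmult ennreal_less_top scaled xy) simp_all
  then have lim: "((\<lambda>c. ennreal (1/2) * \<rho> (scale (c * 2) x) + ennreal (1/2) * \<rho> (scale (c * 2) y)) \<longlongrightarrow> 0) (at 0)"
    by (simp only: mult_zero_right add_0_left)
  have bound: "\<rho> (scale c (x + y)) \<le> ennreal (1/2) * \<rho> (scale (c * 2) x) + ennreal (1/2) * \<rho> (scale (c * 2) y)" for c
    using modular_convex[of "1/2" "1/2" "scale (c * 2) x" "scale (c * 2) y"]
    by (simp add: scale_right_distrib)
  show "x + y \<in> modular_space scale \<rho>"
    unfolding modular_space_def mem_Collect_eq
    by (intro tendsto_sandwich[OF _ _ tendsto_const lim] always_eventually allI bound) simp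
qed

text \<open>An infinite value at \<open>x\<close> would pass down to \<open>x/2\<close>,
  \<open>x/4\<close>, ... by the doubling bound, although these modulars tend to 0.\<close>

lemma modular_finite:
  assumes "Delta2_condition scale \<rho> \<kappa>" and x: "x \<in> modular_space scale \<rho>"
  shows "\<rho> x < \<infinity>"
proof (rule ccontr)
  assume inf: "\<not> \<rho> x < \<infinity>"
  have infinite: "\<rho> (scale ((1/2) ^ n) x) = \<infinity>" for n
  proof (induction n)
    case 0
    from inf show ?case by (simp add: not_less top_unique)
  next
    case (Suc n)
    have "scale ((1/2) ^ Suc n) x \<in> modular_space scale \<rho>"
      using subspace_modular_space x by (rule subspace_scale)
    then have "\<rho> (scale 2 (scale ((1/2) ^ Suc n) x)) \<le> ennreal \<kappa> * \<rho> (scale ((1/2) ^ Suc n) x)"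
      using assms(1) unfolding Delta2_condition_def by blast
    \<comment> \<open>The left-hand side is infinite by induction and \<kappa> is finite, so the
      other factor must be infinite.\<close>
    with Suc show ?case
      by (auto simp: top_unique ennreal_mult_eq_top_iff)
  qed
  have "filterlim (\<lambda>n. (1/2) ^ n :: complex) (at 0) sequentially"
    by (auto simp: filterlim_at intro!: tendsto_power_zero LIMSEQ_power_zero)
  with x have "(\<lambda>n. \<rho> (scale ((1/2) ^ n) x)) \<longlonglongrightarrow> 0"
    unfolding modular_space_def by (auto intro: filterlim_compose)
  then show False by (simp add: infinite LIMSEQ_const_iff)
qed

text \<open>Polar decomposition: \<rho> ignores the phase \<open>sgn s\<close>, and scaling by
  \<open>cmod s\<close> is a convex combination with the point 0.\<close>

lemma modular_scale_le:
  assumes "cmod s \<le> 1"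
  shows "\<rho> (scale s x) \<le> ennreal (cmod s) * \<rho> x"
proof (cases "s = 0")
  case True
  then show ?thesis by (simp add: modular_eq_0_iff[THEN iffD2])
next
  case False
  have "\<rho> (scale s x) = \<rho> (scale (complex_of_real (cmod s)) (scale (sgn s) x))"
    using False by (simp add: sgn_eq)
  also have "\<dots> \<le> ennreal (cmod s) * \<rho> (scale (sgn s) x)"
    using modular_convex[of "cmod s" "1 - cmod s" "scale (sgn s) x" 0] assms
    by (simp add: modular_eq_0_iff[THEN iffD2])
  also have "\<rho> (scale (sgn s) x) = \<rho> x"
    using False by (simp add: modular_scale_unit norm_sgn)
  finally show ?thesis .
qed

lemma eq_0_if_modular_le_scale:
  assumes "\<rho> x < \<infinity>" "cmod s < 1" "\<rho> x \<le> \<rho> (scale s x)"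
  shows "x = 0"
proof (rule ccontr)
  assume "x \<noteq> 0"
  then have pos: "0 < \<rho> x" by (simp add: modular_eq_0_iff zero_less_iff_neq_zero)
  have "\<rho> x \<le> ennreal (cmod s) * \<rho> x"
    using assms modular_scale_le[of s x] by (auto intro: order_trans)
  \<comment> \<open>Strictness rests on \<rho> x being both positive and finite.\<close>
  also have "\<dots> < 1 * \<rho> x"
    using pos assms by (intro ennreal_mult_strict_right_mono) auto
  finally show False by simp
qed

end

text \<open>The choice y = x with \<open>g 0 = 0\<close> gives g (2 x) = 2 g x; the midpoint x and
  half-difference y of u and v then turn Jensen's equation into additivity. The scalars serve to
  halve in the domain.\<close>

lemma additive_if_Jensen:
  fixes scale :: "complex \<Rightarrow> 'a::ab_group_add \<Rightarrow> 'a" and g :: "'a \<Rightarrow> 'b::ab_group_add"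
  assumes "vector_space scale" and "g 0 = 0"
    and jensen: "\<And>x y. g (x + y) + g (x - y) = g x + g x"
  shows "additive g"
proof
  interpret vector_space scale by fact
  fix u v
  define x y where "x = scale (1/2) (u + v)" and "y = scale (1/2) (u - v)"
  have half: "scale (1/2) a + scale (1/2) a = a" for a
    by (simp flip: scale_left_distrib)
  have "x + y = scale (1/2) u + scale (1/2) u" "x - y = scale (1/2) v + scale (1/2) v"
    "x + x = u + v"
    by (simp_all add: x_def y_def scale_right_distrib scale_right_diff_distrib half)
       (simp_all add: algebra_simps half)
  then have "x + y = u" "x - y = v" "x + x = u + v" by (simp_all add: half)
  then show "g (u + v) = g u + g v"
    using jensen[of x y] jensen[of x x] assms(2) by simp
qed

theorem lemma2p1:
  fixes scaleA :: "complex \<Rightarrow> 'a::ring \<Rightarrow> 'a" (infixr "*\<^sub>A" 75)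
    and scaleX :: "complex \<Rightarrow> 'x::ab_group_add \<Rightarrow> 'x" (infixr "*\<^sub>X" 75)
    and \<rho> :: "'x \<Rightarrow> ennreal"
    and \<kappa> :: real
    and s :: complex
    and f :: "'a \<Rightarrow> 'a \<Rightarrow> 'x"
  assumes algebra: "complex_algebra scaleA"
    and modular: "convex_modular scaleX \<rho>"
    and complete: "modular_complete scaleX \<rho>"
    and Fatou: "Fatou_property scaleX \<rho>"
    and kappa: "0 < \<kappa>" "\<kappa> \<le> 2"
    and Delta2: "Delta2_condition scaleX \<rho> \<kappa>"
    and s: "s \<noteq> 0" "cmod s < 1"
    and f_range: "\<And>x y. f x y \<in> modular_space scaleX \<rho>"
    and f_zero: "\<And>x. f x 0 = 0" "\<And>x. f 0 x = 0"
    and f_ineq: "\<And>l x y z w. cmod l = 1 \<Longrightarrow>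
      \<rho> (f (l *\<^sub>A (x + y)) (z + w) + f (l *\<^sub>A (x + y)) (z - w)
          + f (l *\<^sub>A (x - y)) (z + w) + f (l *\<^sub>A (x - y)) (z - w)
          - (4 * l) *\<^sub>X f x z)
      \<le> \<rho> ((4 * s) *\<^sub>X (f ((1/2) *\<^sub>A (x + y)) (z - w) + f ((1/2) *\<^sub>A (x - y)) (z + w)
          - f x z + f y w))"
  shows "bi_additive f"
proof -
  interpret X: convex_modular scaleX \<rho> by fact
  interpret A: complex_algebra scaleA by fact
  have quadruple: "4 *\<^sub>X v = v + v + v + v" for v
    using X.scale_left_distrib[of 2 2 v] X.scale_left_distrib[of 1 1 v] by (simp add: add.assoc)
  have halves: "(1/2) *\<^sub>A x + (1/2) *\<^sub>A x = x" for x
    by (simp flip: A.scale_left_distrib)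
  have cancel: "v = 0" if "v + v = 0" for v :: 'x
  proof -
    have "2 *\<^sub>X v = v + v" using X.scale_left_distrib[of 1 1 v] by simp
    with that show ?thesis using X.scale_eq_0_iff[of 2 v] by simp
  qed
  have double: "f (x + x) z = f x z + f x z" for x z
  proof -
    \<comment> \<open>On the right \<open>f x z\<close> cancels, and the remaining terms have a zero
      argument.\<close>
    have "\<rho> (f (x + x) z + f (x + x) z - 4 *\<^sub>X f x z) = 0"
      using f_ineq[of 1 x x z 0]
      by (simp add: f_zero A.scale_right_distrib halves X.modular_eq_0_iff[THEN iffD2])
    then have "(f (x + x) z - (f x z + f x z)) + (f (x + x) z - (f x z + f x z)) = 0"
      by (simp add: X.modular_eq_0_iff quadruple algebra_simps)
    from cancel[OF this] show ?thesis by simp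
  qed
  have half: "f x z = f ((1/2) *\<^sub>A x) z + f ((1/2) *\<^sub>A x) z" for x z
    using double[of "(1/2) *\<^sub>A x" z] by (simp add: halves)
  \<comment> \<open>Here \<open>u\<close> and \<open>v\<close> stand for the two values at half
    arguments; their membership in the modular space ensures the finiteness on which the contraction
    argument rests.\<close>
  have vanish: "u + v = f x z" if "\<rho> (4 *\<^sub>X (u + v - f x z)) \<le> \<rho> ((4 * s) *\<^sub>X (u + v - f x z))"
    "u \<in> modular_space scaleX \<rho>" "v \<in> modular_space scaleX \<rho>" for u v x z
  proof -
    have "4 *\<^sub>X (u + v - f x z) \<in> modular_space scaleX \<rho>"
      using that f_range X.subspace_modular_space
      by (intro X.subspace_scale X.subspace_diff X.subspace_add)
    then have "4 *\<^sub>X (u + v - f x z) = 0"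
      using that(1) X.modular_finite[OF Delta2] s
      by (intro X.eq_0_if_modular_le_scale[of _ s]) (simp_all add: mult.commute)
    then show ?thesis by simp
  qed
  have jensen_right: "f x (z + w) + f x (z - w) = f x z + f x z" for x z w
  proof -
    \<comment> \<open>With y = 0, halving the first argument turns each pair of equal terms into
      four copies of a value at x/2, so the left side becomes 4 times the bracket on the
      right.\<close>
    have "f x (z + w) + f x (z - w) + f x (z + w) + f x (z - w) - 4 *\<^sub>X f x z
        = 4 *\<^sub>X (f ((1/2) *\<^sub>A x) (z - w) + f ((1/2) *\<^sub>A x) (z + w) - f x z)"
      unfolding half[of x "z + w"] half[of x "z - w"] quadruple by (simp add: algebra_simps)
    then have eq: "f ((1/2) *\<^sub>A x) (z - w) + f ((1/2) *\<^sub>A x) (z + w) = f x z"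
      using f_ineq[of 1 x 0 z w] by (intro vanish f_range) (simp add: f_zero)
    \<comment> \<open>Doubling \<open>eq\<close> restores the full first argument by
      \<open>half\<close>.\<close>
    then show ?thesis
      unfolding half[of x "z + w"] half[of x "z - w"] by (simp add: ac_simps flip: eq)
  qed
  have jensen_left: "f (x + y) z + f (x - y) z = f x z + f x z" for x y z
  proof -
    \<comment> \<open>The same collection with w = 0, now halving x + y and x - y.\<close>
    have "f (x + y) z + f (x + y) z + f (x - y) z + f (x - y) z - 4 *\<^sub>X f x z
        = 4 *\<^sub>X (f ((1/2) *\<^sub>A (x + y)) z + f ((1/2) *\<^sub>A (x - y)) z - f x z)"
      unfolding half[of "x + y" z] half[of "x - y" z] quadruple by (simp add: algebra_simps)
    then have eq: "f ((1/2) *\<^sub>A (x + y)) z + f ((1/2) *\<^sub>A (x - y)) z = f x z"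
      using f_ineq[of 1 x y z 0] by (intro vanish f_range) (simp add: f_zero)
    then show ?thesis
      unfolding half[of "x + y" z] half[of "x - y" z] by (simp add: ac_simps flip: eq)
  qed
  show ?thesis
    unfolding bi_additive_def
    by (intro conjI allI additive_if_Jensen[OF A.vector_space_axioms] f_zero jensen_left jensen_right)
qed

end
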